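(* Let $p(z)$ be a cubic polynomial with complex coefficients having three distinct roots and two distinct critical points. Then at least one critical point of $p$ has the Voronoi property; that is, there exist a critical point $c$ of $p$ (so $p'(c)=0$) and a root $\theta$ of $p$ such that $|c-\theta|<|c-\theta'|$ for every root $\theta'\neq\theta$ of $p$.
   Context: For a finite set $S=\{\theta_1,\dots,\theta_n\}\subset\mathbb{C}$ and $\theta\in S$, the Voronoi cell of $\theta$ is $V(\theta)=\{z\in\mathbb{C}: |z-\theta|<|z-\theta'| \text{ for all } \theta'\in S,\ \theta'\neq\theta\}$, the set of points strictly closer to $\theta$ than to any other point of $S$. Here $S$ is the set of roots of $p$. A critical point $c$ of $p$, i.e. a solution of $p'(z)=0$, has the Voronoi property if $c\in V(\theta)$ for some root $\theta$ of $p$. *)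

theory Defs
  imports "HOL-Analysis.Analysis" "HOL-Computational_Algebra.Polynomial"
begin

definition poly_roots :: "complex poly \<Rightarrow> complex set" where
  "poly_roots p = {z. poly p z = 0}"

definition critical_points :: "complex poly \<Rightarrow> complex set" where
  "critical_points p = {z. poly (pderiv p) z = 0}"

definition voronoi_cell :: "complex set \<Rightarrow> complex \<Rightarrow> complex set" where
  "voronoi_cell S \<theta> = {z. \<forall>\<theta>'\<in>S. \<theta>' \<noteq> \<theta> \<longrightarrow> cmod (z - \<theta>) < cmod (z - \<theta>')}"

definition has_voronoi_property :: "complex poly \<Rightarrow> complex \<Rightarrow> bool" where
  "has_voronoi_property p c \<longleftrightarrow> (\<exists>\<theta>\<in>poly_roots p. c \<in> voronoi_cell (poly_roots p) \<theta>)"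

end

theory Submission
  imports Defs
begin

text \<open>
  A critical point \<open>w\<close> of a cubic with roots \<open>a, b, d\<close> that lies at equal distance from \<open>a\<close> and
  \<open>b\<close> forces \<open>d\<close> onto the perpendicular bisector of \<open>a, b\<close>: with \<open>w = 0\<close> the equation reads
  \<open>d (a + b) = - a b\<close>. Suppose neither critical point has the Voronoi property, so that each has
  two nearest roots. If the two tied pairs differ, the triangle is equilateral and the critical
  points coincide. If they agree, the critical points lie on the axis of an isosceles triangle;
  in coordinates with \<open>a, b = \<plusminus> 1\<close> they are \<open>\<i> s\<close> and \<open>\<i> s'\<close> with \<open>3 s s' = 1\<close>, and the
  two distance inequalities become \<open>(s + 3 s') (s - s') \<le> 0\<close> and
  \<open>(s' + 3 s) (s' - s) \<le> 0\<close>, which is impossible.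
\<close>

definition cubic_deriv :: "complex \<Rightarrow> complex \<Rightarrow> complex \<Rightarrow> complex \<Rightarrow> complex" where
  "cubic_deriv a b d w = (w - a) * (w - b) + (w - a) * (w - d) + (w - b) * (w - d)"

definition tied_nearest :: "complex \<Rightarrow> complex \<Rightarrow> complex \<Rightarrow> complex \<Rightarrow> bool" where
  "tied_nearest a b d w \<longleftrightarrow> cmod (w - a) = cmod (w - b) \<and> cmod (w - a) \<le> cmod (w - d)"

lemma cubic_poly_eq_prod_roots:
  fixes p :: "'a::field poly"
  assumes deg: "degree p = 3"
    and roots: "poly p a = 0" "poly p b = 0" "poly p d = 0"
    and ne: "a \<noteq> b" "a \<noteq> d" "b \<noteq> d"
  obtains k where "k \<noteq> 0" "p = smult k ([:- a, 1:] * [:- b, 1:] * [:- d, 1:])"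
proof -
  obtain q where q: "p = [:- a, 1:] * q"
    using roots(1) by (auto simp: poly_eq_0_iff_dvd elim: dvdE)
  have "poly q b = 0" using roots(2) ne(1) q by auto
  then obtain r where r: "q = [:- b, 1:] * r"
    by (auto simp: poly_eq_0_iff_dvd elim: dvdE)
  have "poly r d = 0" using roots(3) ne(2,3) q r by auto
  then obtain s where s: "r = [:- d, 1:] * s"
    by (auto simp: poly_eq_0_iff_dvd elim: dvdE)
  have p: "p = ([:- a, 1:] * [:- b, 1:] * [:- d, 1:]) * s"
    unfolding q r s by (simp only: mult.assoc)
  have "s \<noteq> 0" using deg p by auto
  then have "degree p = 3 + degree s"
    unfolding p by (subst degree_mult_eq; simp add: degree_mult_eq)
  then have "degree s = 0" using deg by simp
  then obtain k where k: "s = [:k:]" by (elim degree_eq_zeroE)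
  show ?thesis
  proof
    show "k \<noteq> 0" using k \<open>s \<noteq> 0\<close> by auto
    show "p = smult k ([:- a, 1:] * [:- b, 1:] * [:- d, 1:])"
      unfolding p k by simp
  qed
qed

lemma poly_pderiv_cubic:
  "poly (pderiv (smult k ([:- a, 1:] * [:- b, 1:] * [:- d, 1:]))) w = k * cubic_deriv a b d w"
  unfolding cubic_deriv_def
  by (simp add: pderiv_smult pderiv_mult pderiv_pCons algebra_simps)

text \<open>The least of three distances is always attained, so without a strict minimum it is
  shared by two roots. The three cyclic disjuncts say which root is left over, in third
  place.\<close>

lemma tied_nearest_if_not_voronoi:
  assumes "poly_roots p = {a, b, d}" and "\<not> has_voronoi_property p w"
  shows "tied_nearest a b d w \<or> tied_nearest b d a w \<or> tied_nearest d a b w"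
  using assms unfolding has_voronoi_property_def voronoi_cell_def tied_nearest_def
  by (auto simp: norm_minus_commute)

lemma cubic_deriv_perm:
  "cubic_deriv b d a w = cubic_deriv a b d w" "cubic_deriv d a b w = cubic_deriv a b d w"
  by (simp_all add: cubic_deriv_def algebra_simps)

lemma apex_equidistant:
  assumes crit: "cubic_deriv a b d w = 0"
    and eq: "cmod (w - a) = cmod (w - b)" and ne: "a \<noteq> b"
  shows "cmod (d - a) = cmod (d - b)"
proof -
  define A B D where "A = a - w" and "B = b - w" and "D = d - w"
  have rel: "A * B + A * D + B * D = 0"
    using crit unfolding cubic_deriv_def A_def B_def D_def by (simp add: algebra_simps)
  have AB: "cmod A = cmod B"
    using eq unfolding A_def B_def by (simp add: norm_minus_commute)
  have "A \<noteq> B" using ne unfolding A_def B_def by simp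
  then have nz: "A \<noteq> 0" "B \<noteq> 0" using AB by auto
  have sum: "A + B \<noteq> 0"
  proof
    assume "A + B = 0"
    moreover have "A * B + (A + B) * D = 0" using rel by (simp add: algebra_simps)
    ultimately show False using nz by simp
  qed
  \<comment> \<open>The factor \<open>A + B\<close> allows \<open>D\<close> to be eliminated through
    \<open>D * (A + B) = - (A * B)\<close>.\<close>
  have "(D - A) * (A + B) = - (A * (A + 2 * B))" "(D - B) * (A + B) = - (B * (2 * A + B))"
    using rel by algebra+
  then have *: "cmod (D - A) * cmod (A + B) = cmod A * cmod (A + 2 * B)"
      "cmod (D - B) * cmod (A + B) = cmod B * cmod (2 * A + B)"
    by (metis norm_mult norm_minus_cancel)+
  \<comment> \<open>Both squares have the same cross term \<open>4 * Re (A * cnj B)\<close>; the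
    rest agrees because \<open>A\<close> and \<open>B\<close> have equal modulus.\<close>
  have "(cmod (A + 2 * B))\<^sup>2 = (cmod (2 * A + B))\<^sup>2"
    using arg_cong[OF AB, of "\<lambda>x. x\<^sup>2"] unfolding cmod_power2
    by (simp add: power2_eq_square algebra_simps)
  then have "cmod (A + 2 * B) = cmod (2 * A + B)" by simp
  then have "cmod (D - A) * cmod (A + B) = cmod (D - B) * cmod (A + B)"
    using * AB by (simp only:)
  then have "cmod (D - A) = cmod (D - B)"
    using sum by (simp only: mult_cancel_right norm_eq_zero simp_thms)
  then show ?thesis unfolding A_def B_def D_def by simp
qed

lemma equilateral_imp:
  assumes "cmod (a - b) = cmod (b - d)" and "cmod (b - d) = cmod (d - a)"
  shows "a\<^sup>2 + b\<^sup>2 + d\<^sup>2 = a * b + b * d + d * a"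
proof -
  define u v where "u = a - d" and "v = b - d"
  have "cmod u = cmod v" "cmod (u - v) = cmod v"
    using assms by (simp_all add: u_def v_def norm_minus_commute)
  then have n: "u * cnj u = v * cnj v" "(u - v) * cnj (u - v) = v * cnj v"
    by (simp_all only: complex_norm_square[symmetric])
  \<comment> \<open>The relations \<open>n\<close> give
    \<open>u * cnj v + v * cnj u = v * cnj v\<close>. Multiply by \<open>u * v\<close> and replace
    \<open>u * cnj u\<close> by \<open>v * cnj v\<close>.\<close>
  have "(u\<^sup>2 - u * v + v\<^sup>2) * (v * cnj v) = 0"
    using n unfolding complex_cnj_diff by algebra
  then have "u\<^sup>2 - u * v + v\<^sup>2 = 0"
    using n by (cases "v = 0") auto
  then show ?thesis unfolding u_def v_def by algebra
qed

text \<open>Vieta's formulas for the quadratic \<open>3 * z\<^sup>2 - 2 * (a + b + d) * z + (a * b +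
  b * d + d * a)\<close>. Subtracting its values at the two zeros and cancelling
  \<open>w - w'\<close> yields the sum.\<close>

lemma cubic_deriv_vieta:
  assumes "cubic_deriv a b d w = 0" "cubic_deriv a b d w' = 0" "w \<noteq> w'"
  shows "3 * (w + w') = 2 * (a + b + d)" "3 * (w * w') = a * b + b * d + d * a"
proof -
  have "(w - w') * (3 * (w + w') - 2 * (a + b + d)) = 0"
    using assms(1,2) unfolding cubic_deriv_def by algebra
  then show *: "3 * (w + w') = 2 * (a + b + d)" using assms(3) by simp
  show "3 * (w * w') = a * b + b * d + d * a"
    using * assms(1) unfolding cubic_deriv_def by algebra
qed

text \<open>The coordinate \<open>(z - m) / h\<close> moves the two points to 1 and -1, whose
  bisector is the imaginary axis.\<close>

lemma equidistant_imp_on_bisector: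
  assumes "cmod (z - (m + h)) = cmod (z - (m - h))" and "h \<noteq> 0"
  obtains s :: real where "z = m + \<i> * h * of_real s"
proof -
  define y where "y = (z - m) / h"
  have z: "z = m + h * y" using assms(2) by (simp add: y_def)
  have "z - (m + h) = h * (y - 1)" "z - (m - h) = h * (y + 1)"
    unfolding z by (simp_all add: algebra_simps)
  then have "cmod (y - 1) = cmod (y + 1)" using assms by (simp add: norm_mult)
  then have "(cmod (y - 1))\<^sup>2 = (cmod (y + 1))\<^sup>2" by simp
  then have "Re y = 0" unfolding cmod_power2 by (simp add: power2_eq_square algebra_simps)
  then have "y = \<i> * of_real (Im y)" by (simp add: complex_eq_iff)
  then have "z = m + \<i> * h * of_real (Im y)" using z by (metis mult.assoc mult.commute)
  then show ?thesis by (rule that)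
qed

lemma axis_point_dist_le:
  fixes s t :: real
  assumes "cmod (m + \<i> * h * of_real s - (m + h)) \<le> cmod (m + \<i> * h * of_real s - (m + \<i> * h * of_real t))"
    and "h \<noteq> 0"
  shows "s\<^sup>2 + 1 \<le> (s - t)\<^sup>2"
proof -
  have "m + \<i> * h * of_real s - (m + h) = h * (\<i> * of_real s - 1)"
    "m + \<i> * h * of_real s - (m + \<i> * h * of_real t) = h * (\<i> * of_real (s - t))"
    by (simp_all add: algebra_simps)
  then have "cmod (\<i> * of_real s - 1) \<le> cmod (\<i> * of_real (s - t))"
    using assms by (simp add: norm_mult)
  then have "(cmod (\<i> * of_real s - 1))\<^sup>2 \<le> (cmod (\<i> * of_real (s - t)))\<^sup>2"
    by (simp add: power_mono)
  then show ?thesis by (simp add: cmod_power2)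
qed

lemma axis_inequalities_contradiction:
  fixes s s' t :: real
  assumes "3 * (s + s') = 2 * t" "3 * (s * s') = 1" "s < s'"
    and "s\<^sup>2 + 1 \<le> (s - t)\<^sup>2" "s'\<^sup>2 + 1 \<le> (s' - t)\<^sup>2"
  shows False
proof -
  have t: "t = 3 * (s + s') / 2" using assms(1) by simp
  \<comment> \<open>Write 1 as \<open>3 * (s * s')\<close> and \<open>s - t\<close> as
    \<open>- (s + 3 * s') / 2\<close>; the difference of the two sides then factors. The second
    inequality is symmetric.\<close>
  have "(s + 3 * s') * (s - s') \<le> 0" "(s' + 3 * s) * (s' - s) \<le> 0"
    using assms(2,4,5) unfolding t by (simp_all add: power2_eq_square field_simps)
  then have *: "s + 3 * s' \<ge> 0" "s' + 3 * s \<le> 0"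
    using assms(3) by (auto simp: mult_le_0_iff)
  have "s * s' > 0" using assms(2) by linarith
  \<comment> \<open>\<open>s\<close> and \<open>s'\<close> have the same sign: both positive
    violates the second inequality of \<open>*\<close>, both negative the first.\<close>
  then show False using * assms(3) by (auto simp: zero_less_mult_iff)
qed

lemma not_both_tied_same_pair:
  assumes crit: "cubic_deriv a b d w = 0" "cubic_deriv a b d w' = 0" "w \<noteq> w'"
    and ne: "a \<noteq> b"
    and tie: "tied_nearest a b d w" "tied_nearest a b d w'"
  shows False
proof -
  define m h where "m = (a + b) / 2" and "h = (a - b) / 2"
  have ab: "a = m + h" "b = m - h" unfolding m_def h_def by (simp_all add: field_simps)
  have h: "h \<noteq> 0" using ne by (simp add: h_def)
  have eq: "cmod (w - a) = cmod (w - b)" "cmod (w' - a) = cmod (w' - b)"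
    using tie by (auto simp: tied_nearest_def)
  obtain t where t: "d = m + \<i> * h * of_real t"
    using equidistant_imp_on_bisector apex_equidistant[OF crit(1) eq(1) ne] ab h by metis
  obtain s where s: "w = m + \<i> * h * of_real s"
    using equidistant_imp_on_bisector eq(1) ab h by metis
  obtain s' where s': "w' = m + \<i> * h * of_real s'"
    using equidistant_imp_on_bisector eq(2) ab h by metis
  have le: "s\<^sup>2 + 1 \<le> (s - t)\<^sup>2" "s'\<^sup>2 + 1 \<le> (s' - t)\<^sup>2"
    using tie axis_point_dist_le h unfolding tied_nearest_def ab s s' t by blast+
  note vieta = cubic_deriv_vieta[OF crit]
  have "\<i> * h * (3 * (of_real s + of_real s')) = \<i> * h * (2 * of_real t)"
    using vieta(1) unfolding ab s s' t by algebra
  then have "complex_of_real (3 * (s + s')) = of_real (2 * t)" using h by simp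
  then have sum: "3 * (s + s') = 2 * t" by (simp only: of_real_eq_iff)
  \<comment> \<open>In the product formula the terms in \<open>m\<close> cancel by the sum formula;
    what remains of \<open>a * b\<close> is \<open>- h\<^sup>2\<close>, which is
    \<open>(\<i> * h)\<^sup>2\<close>.\<close>
  have "(\<i> * h)\<^sup>2 * (3 * (of_real s * of_real s')) = (\<i> * h)\<^sup>2 * 1"
    using vieta unfolding ab s s' t power_mult_distrib i_squared
    using i_squared by algebra
  then have "complex_of_real (3 * (s * s')) = of_real 1" using h by simp
  then have prod: "3 * (s * s') = 1" by (simp only: of_real_eq_iff)
  have "s < s' \<or> s' < s" using crit(3) s s' by auto
  then show False
    using axis_inequalities_contradiction[of s s' t] axis_inequalities_contradiction[of s' s t]
      sum prod le by (auto simp: ac_simps)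
qed

text \<open>By Vieta, \<open>9 * (w - w')\<^sup>2\<close> is four times
  \<open>a\<^sup>2 + b\<^sup>2 + d\<^sup>2 - a * b - b * d - d * a\<close>, which vanishes for
  equilateral triangles.\<close>

lemma not_equilateral:
  assumes crit: "cubic_deriv a b d w = 0" "cubic_deriv a b d w' = 0" "w \<noteq> w'"
  shows "\<not> (cmod (a - b) = cmod (b - d) \<and> cmod (b - d) = cmod (d - a))"
proof
  assume "cmod (a - b) = cmod (b - d) \<and> cmod (b - d) = cmod (d - a)"
  then have "a\<^sup>2 + b\<^sup>2 + d\<^sup>2 = a * b + b * d + d * a" using equilateral_imp by blast
  then have "9 * (w - w')\<^sup>2 = 0" using cubic_deriv_vieta[OF crit] by algebra
  then show False using crit(3) by simp
qed

theorem theorem1: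
  fixes p :: "complex poly"
  assumes "degree p = 3"
    and "card (poly_roots p) = 3"
    and "card (critical_points p) = 2"
  shows "\<exists>c\<in>critical_points p. has_voronoi_property p c"
proof (rule ccontr)
  assume none: "\<not> ?thesis"
  obtain a b d where roots: "poly_roots p = {a, b, d}" and ne: "a \<noteq> b" "a \<noteq> d" "b \<noteq> d"
    using assms(2) by (auto simp: card_3_iff)
  obtain w w' where crits: "critical_points p = {w, w'}" and w: "w \<noteq> w'"
    using assms(3) by (auto simp: card_2_iff)
  have "poly p a = 0" "poly p b = 0" "poly p d = 0"
    using roots by (auto simp: poly_roots_def)
  then obtain k where k: "k \<noteq> 0" "p = smult k ([:- a, 1:] * [:- b, 1:] * [:- d, 1:])"
    using cubic_poly_eq_prod_roots assms(1) ne by metis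
  have "cubic_deriv a b d z = 0" if "z \<in> critical_points p" for z
    using that k(1) unfolding critical_points_def k(2) poly_pderiv_cubic by simp
  then have crit: "cubic_deriv a b d w = 0" "cubic_deriv a b d w' = 0"
    using crits by auto
  then have perm: "cubic_deriv b d a w = 0" "cubic_deriv b d a w' = 0"
      "cubic_deriv d a b w = 0" "cubic_deriv d a b w' = 0"
    by (simp_all add: cubic_deriv_perm[where a = a and b = b and d = d])
  have ties: "tied_nearest a b d z \<or> tied_nearest b d a z \<or> tied_nearest d a b z"
    if "z \<in> {w, w'}" for z
    using tied_nearest_if_not_voronoi[OF roots] none crits that by blast
  have same: "\<not> (tied_nearest a b d w \<and> tied_nearest a b d w')"
    "\<not> (tied_nearest b d a w \<and> tied_nearest b d a w')"
    "\<not> (tied_nearest d a b w \<and> tied_nearest d a b w')"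
    using not_both_tied_same_pair[OF crit w] not_both_tied_same_pair[OF perm(1,2) w]
      not_both_tied_same_pair[OF perm(3,4) w] ne by auto
  have crit': "cubic_deriv a b d z = 0" "cubic_deriv b d a z = 0" "cubic_deriv d a b z = 0"
    if "z \<in> {w, w'}" for z
    using that crit perm by auto
  have apex: "tied_nearest a b d z \<Longrightarrow> cmod (d - a) = cmod (b - d)"
    "tied_nearest b d a z \<Longrightarrow> cmod (a - b) = cmod (d - a)"
    "tied_nearest d a b z \<Longrightarrow> cmod (b - d) = cmod (a - b)" if "z \<in> {w, w'}" for z
    using apex_equidistant[OF crit'(1)[OF that]] apex_equidistant[OF crit'(2)[OF that]]
      apex_equidistant[OF crit'(3)[OF that]] ne
    unfolding tied_nearest_def by (simp_all add: norm_minus_commute)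
  \<comment> \<open>By \<open>same\<close>, \<open>w\<close> and \<open>w'\<close> are tied for
    different pairs; any two of the three equalities in \<open>apex\<close> make all sides
    equal.\<close>
  show False
    using ties[of w] ties[of w'] same apex[of w] apex[of w'] not_equilateral[OF crit w] by simp argo
qed

end
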